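(* Let $F:\{-1,1\}^{4n}\to\{-1,1\}$ be any symmetric function, and let $r\ge4$ be its odd-even degree. Then there exists a universal constant $c>0$ such that $\mathsf{PP}(F\circ\mathsf{XOR})\ge cr/\log(n/r)$.
   Context: $F$ symmetric: its value depends only on the number $i$ of coordinates equal to $-1$, given by a predicate $D_F(i)$; the odd-even degree is $|\{i\in\{0,\dots,4n-2\}:D_F(i)\ne D_F(i+2)\}|$. $(F\circ\mathsf{XOR})(x,y)=F(x_1y_1,\dots,x_{4n}y_{4n})$ for $x,y\in\{-1,1\}^{4n}$, where Alice holds $x$ and Bob holds $y$. For a two-party function $G$ and $\epsilon>0$, $R_\epsilon(G)$ is the minimum cost (worst-case number of bits communicated) of a private-coin randomized protocol $\Pi$ with $\Pr[\Pi(x,y)=G(x,y)]\ge 1/2+\epsilon$ for all inputs; $\mathsf{PP}(G)=\min_{\epsilon>0}\big(R_\epsilon(G)+\log(1/\epsilon)\big)$.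
   Formalization: The denominator log(n/r) is replaced by max(1, log_2(n/r)): as stated the bound fails for r = n-1, where r/log(n/r) is of order n^2 while PP is at most 4n+2, and it is undefined at r = n. *)

theory Defs
  imports "HOL-Probability.Probability"
begin

definition cube :: "nat \<Rightarrow> int list set" where
  "cube m = {x. length x = m \<and> set x \<subseteq> {-1, 1}}"

definition symmetric_on_cube :: "nat \<Rightarrow> (int list \<Rightarrow> int) \<Rightarrow> bool" where
  "symmetric_on_cube m F \<longleftrightarrow>
     (\<forall>x\<in>cube m. \<forall>y\<in>cube m. count_list x (-1) = count_list y (-1) \<longrightarrow> F x = F y)"

(* The predicate D_F of a symmetric F, read off at a representative point of weight i;
   meaningful for i \<le> m. *)
definition symm_predicate :: "nat \<Rightarrow> (int list \<Rightarrow> int) \<Rightarrow> nat \<Rightarrow> int" where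
  "symm_predicate m F i = F (replicate i (-1) @ replicate (m - i) 1)"

definition odd_even_degree :: "nat \<Rightarrow> (int list \<Rightarrow> int) \<Rightarrow> nat" where
  "odd_even_degree m F =
     card {i \<in> {0..m - 2}. symm_predicate m F i \<noteq> symm_predicate m F (i + 2)}"

definition compose_XOR :: "(int list \<Rightarrow> int) \<Rightarrow> int list \<Rightarrow> int list \<Rightarrow> int" where
  "compose_XOR F x y = F (map2 (*) x y)"

(* Two-party protocol trees. At an inner node the owner sends the bit given by the label; the
   protocol continues in the first subtree on True and in the second on False. *)
datatype ('a, 'b, 'z) protocol_tree =
    Leaf 'z
  | Alice "'a \<Rightarrow> bool" "('a, 'b, 'z) protocol_tree" "('a, 'b, 'z) protocol_tree"
  | Bob "'b \<Rightarrow> bool" "('a, 'b, 'z) protocol_tree" "('a, 'b, 'z) protocol_tree"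

fun tree_output :: "('a, 'b, 'z) protocol_tree \<Rightarrow> 'a \<Rightarrow> 'b \<Rightarrow> 'z" where
  "tree_output (Leaf z) a b = z"
| "tree_output (Alice f s t) a b = (if f a then tree_output s a b else tree_output t a b)"
| "tree_output (Bob g s t) a b = (if g b then tree_output s a b else tree_output t a b)"

fun tree_bits :: "('a, 'b, 'z) protocol_tree \<Rightarrow> 'a \<Rightarrow> 'b \<Rightarrow> nat" where
  "tree_bits (Leaf z) a b = 0"
| "tree_bits (Alice f s t) a b = Suc (if f a then tree_bits s a b else tree_bits t a b)"
| "tree_bits (Bob g s t) a b = Suc (if g b then tree_bits s a b else tree_bits t a b)"

(* Each player's messages depend on the own input and the own private random string. The two
   strings are drawn independently, each from an arbitrary discrete distribution. *)
record ('x, 'y, 'z) private_coin_protocol =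
  alice_coins :: "bool list pmf"
  bob_coins :: "bool list pmf"
  tree :: "('x \<times> bool list, 'y \<times> bool list, 'z) protocol_tree"

definition success_prob ::
    "('x, 'y, 'z) private_coin_protocol \<Rightarrow> ('x \<Rightarrow> 'y \<Rightarrow> 'z) \<Rightarrow> 'x \<Rightarrow> 'y \<Rightarrow> real" where
  "success_prob P G x y =
     measure_pmf.prob (pair_pmf (alice_coins P) (bob_coins P))
       {(ra, rb). tree_output (tree P) (x, ra) (y, rb) = G x y}"

definition protocol_cost ::
    "'x set \<Rightarrow> 'y set \<Rightarrow> ('x, 'y, 'z) private_coin_protocol \<Rightarrow> nat" where
  "protocol_cost X Y P =
     Sup {tree_bits (tree P) (x, ra) (y, rb) | x y ra rb.
            x \<in> X \<and> y \<in> Y \<and> ra \<in> set_pmf (alice_coins P) \<and> rb \<in> set_pmf (bob_coins P)}"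

(* R_eps(G) is infinite if no protocol has advantage eps, in particular for eps > 1/2. *)
definition rand_cc ::
    "'x set \<Rightarrow> 'y set \<Rightarrow> real \<Rightarrow> ('x \<Rightarrow> 'y \<Rightarrow> 'z) \<Rightarrow> enat" where
  "rand_cc X Y \<epsilon> G =
     (INF P \<in> {P. \<forall>x\<in>X. \<forall>y\<in>Y. success_prob P G x y \<ge> 1 / 2 + \<epsilon>}. enat (protocol_cost X Y P))"

definition PP_cc :: "'x set \<Rightarrow> 'y set \<Rightarrow> ('x \<Rightarrow> 'y \<Rightarrow> 'z) \<Rightarrow> ereal" where
  "PP_cc X Y G = (INF \<epsilon> \<in> {0<..}. ereal_of_enat (rand_cc X Y \<epsilon> G) + ereal (log 2 (1 / \<epsilon>)))"

(* The lower bound c r / log(n/r) is to be read with max 1 (log(n/r)) in the denominator. Without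
   the maximum it fails for r = n - 1, where r / log(n/r) is of order n^2 although PP is at most
   4 n + 2 for every function on these inputs; for r \<le> n/2 the maximum equals log 2 (n/r). *)

end

theory Submission
  imports Defs
begin

text \<open>
  A protocol with \<open>C\<close> bits is a sum of at most \<open>2 ^ C\<close> rectangles. Averaging its output over the
  pairs \<open>(x, x z)\<close> gives a function \<open>p z\<close> whose Fourier coefficients sum to at most \<open>2 ^ C\<close> in
  absolute value, since by Cauchy-Schwarz and Parseval each rectangle contributes at most 1, and
  \<open>F z * p z \<ge> 2 \<epsilon>\<close>.

  Now let \<open>z\<close> be random, composed of \<open>m\<close> blocks of 4 coordinates, each uniform among the points of
  weight 1 or among the points of weight 3, the remaining coordinates being constant. A character
  meeting \<open>t\<close> blocks in an odd number of coordinates averages to at most \<open>1 / 2 ^ t\<close> in absolute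
  value, and averaged over the position of the \<open>j\<close> heavy blocks it is a polynomial of degree at
  most \<open>t\<close> in \<open>j\<close>. If \<open>D_F\<close> changes \<open>W\<close> times along \<open>s, s + 2, \<dots>, s + 2 m\<close>, a polynomial of degree
  less than \<open>W\<close> in \<open>j\<close> cannot have the sign of \<open>F\<close> for all \<open>j\<close>, so the characters with \<open>t \<ge> W\<close> must
  make up the margin: \<open>2 \<epsilon> \<le> 2 ^ C / 2 ^ W\<close>.

  The admissible windows are those with \<open>m \<le> s\<close> and \<open>s + 3 m \<le> 4 n\<close>. On the dyadic scales
  \<open>m = n, n / 2, n / 4, \<dots>\<close> down to about \<open>r / 8\<close>, boundedly many of them per scale cover everything
  but about \<open>r / 8\<close> positions at each end, and by pigeonhole one contains a fraction
  \<open>1 / O (log (n / r))\<close> of the \<open>r\<close> changes.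
\<close>

section \<open>Fourier weight of protocols\<close>

definition chi :: "nat set \<Rightarrow> int list \<Rightarrow> real" where
  "chi S x = (\<Prod>i\<in>S. real_of_int (x ! i))"

definition fourier :: "nat \<Rightarrow> nat set \<Rightarrow> (int list \<Rightarrow> real) \<Rightarrow> real" where
  "fourier N S f = (\<Sum>x\<in>cube N. f x * chi S x) / 2 ^ N"

text \<open>The Fourier coefficient at \<open>S\<close> of the function of \<open>z\<close> that
  averages \<open>K x (x z)\<close> over \<open>x\<close>: with \<open>y = x z\<close>,
  \<open>chi S x * chi S y\<close> equals \<open>chi S z\<close>.\<close>

definition corr :: "nat \<Rightarrow> nat set \<Rightarrow> (int list \<Rightarrow> int list \<Rightarrow> real) \<Rightarrow> real" where
  "corr N S K = (\<Sum>x\<in>cube N. \<Sum>y\<in>cube N. K x y * chi S x * chi S y) / 4 ^ N"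

definition spectral_norm :: "nat \<Rightarrow> (int list \<Rightarrow> int list \<Rightarrow> real) \<Rightarrow> real" where
  "spectral_norm N K = (\<Sum>S\<in>Pow {..<N}. \<bar>corr N S K\<bar>)"

section \<open>The cube, its characters and Parseval's identity\<close>

lemma cube_altdef: "cube N = {x. set x \<subseteq> {-1, 1} \<and> length x = N}"
  by (auto simp: cube_def)

lemma finite_cube [simp]: "finite (cube N)"
  unfolding cube_altdef by (rule finite_lists_length_eq) simp

lemma card_cube: "card (cube N) = 2 ^ N"
  unfolding cube_altdef by (subst card_lists_length_eq) (simp_all add: numeral_2_eq_2)

lemma cube_nth: "x \<in> cube N \<Longrightarrow> i < N \<Longrightarrow> x ! i = -1 \<or> x ! i = 1"
  using nth_mem[of i x] by (auto simp: cube_def simp del: nth_mem)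

lemma length_cube: "x \<in> cube N \<Longrightarrow> length x = N"
  by (simp add: cube_def)

lemma cubeI: "length x = N \<Longrightarrow> (\<And>i. i < N \<Longrightarrow> x ! i = -1 \<or> x ! i = 1) \<Longrightarrow> x \<in> cube N"
  by (fastforce simp: cube_def in_set_conv_nth)

lemma cube_mult:
  assumes "x \<in> cube N" "y \<in> cube N"
  shows "map2 (*) x y \<in> cube N"
  using assms cube_nth[of x N] cube_nth[of y N]
  by (intro cubeI) (fastforce simp: length_cube)+

lemma cube_mult_cancel:
  assumes "x \<in> cube N" "y \<in> cube N"
  shows "map2 (*) x (map2 (*) x y) = y"
  using assms cube_nth[of x N]
  by (intro nth_equalityI) (fastforce simp: length_cube)+

lemma chi_mult:
  assumes "x \<in> cube N" "y \<in> cube N" "S \<subseteq> {..<N}"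
  shows "chi S (map2 (*) x y) = chi S x * chi S y"
  unfolding chi_def prod.distrib[symmetric] using assms
  by (intro prod.cong) (auto simp: length_cube)

text \<open>The sum over all \<open>S\<close> factors into the product of the terms
  \<open>x ! i * y ! i + 1\<close>; each is 2 where the points agree and 0 where they
  differ.\<close>

lemma sum_chi_mult:
  assumes "x \<in> cube N" "y \<in> cube N"
  shows "(\<Sum>S\<in>Pow {..<N}. chi S x * chi S y) = (if x = y then 2 ^ N else 0)"
proof -
  have "(\<Sum>S\<in>Pow {..<N}. chi S x * chi S y)
      = (\<Prod>i<N. real_of_int (x ! i) * real_of_int (y ! i) + 1)"
    by (subst prod_add) (auto simp: chi_def prod.distrib)
  also have "\<dots> = (if x = y then 2 ^ N else 0)"
  proof (cases "x = y")
    case True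
    have "(\<Prod>i<N. real_of_int (x ! i) * real_of_int (y ! i) + 1) = (\<Prod>i<N. 2)"
      using cube_nth[OF assms(1)] True by (intro prod.cong) fastforce+
    then show ?thesis using True by simp
  next
    case False
    then obtain i where i: "i < N" "x ! i \<noteq> y ! i"
      using assms by (metis length_cube nth_equalityI)
    then have "real_of_int (x ! i) * real_of_int (y ! i) + 1 = 0"
      using cube_nth[OF assms(1), of i] cube_nth[OF assms(2), of i] by auto
    then show ?thesis using False i by (auto simp: prod_zero_iff)
  qed
  finally show ?thesis .
qed

lemma parseval: "(\<Sum>S\<in>Pow {..<N}. (fourier N S f)\<^sup>2) = (\<Sum>x\<in>cube N. (f x)\<^sup>2) / 2 ^ N"
proof -
  have "(\<Sum>S\<in>Pow {..<N}. (fourier N S f)\<^sup>2)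
      = (\<Sum>S\<in>Pow {..<N}. \<Sum>x\<in>cube N. \<Sum>y\<in>cube N. f x * f y * (chi S x * chi S y)) / 4 ^ N"
    by (simp add: fourier_def power2_eq_square sum_product sum_divide_distrib mult_ac
        flip: power_mult_distrib)
  also have "(\<Sum>S\<in>Pow {..<N}. \<Sum>x\<in>cube N. \<Sum>y\<in>cube N. f x * f y * (chi S x * chi S y))
      = (\<Sum>x\<in>cube N. \<Sum>y\<in>cube N. \<Sum>S\<in>Pow {..<N}. f x * f y * (chi S x * chi S y))"
    by (subst sum.swap, rule sum.cong[OF refl], rule sum.swap)
  also have "\<dots> = (\<Sum>x\<in>cube N. \<Sum>y\<in>cube N. if x = y then f x * f y * 2 ^ N else 0)"
    by (intro sum.cong refl) (auto simp: sum_chi_mult simp flip: sum_distrib_left)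
  also have "\<dots> = (\<Sum>x\<in>cube N. (f x)\<^sup>2) * 2 ^ N"
    by (simp add: power2_eq_square sum_distrib_right)
  also have "\<dots> / 4 ^ N = (\<Sum>x\<in>cube N. (f x)\<^sup>2) / 2 ^ N"
    by (simp add: field_simps flip: power_mult_distrib)
  finally show ?thesis .
qed

section \<open>Spectral norm of rectangles and protocol trees\<close>

lemma sum_fourier_square_le:
  assumes "\<And>x. x \<in> cube N \<Longrightarrow> \<bar>f x\<bar> \<le> 1"
  shows "(\<Sum>S\<in>Pow {..<N}. (fourier N S f)\<^sup>2) \<le> 1"
proof -
  have "(\<Sum>x\<in>cube N. (f x)\<^sup>2) \<le> (\<Sum>x\<in>cube N. 1)"
    using assms by (intro sum_mono) (simp add: abs_square_le_1)
  then show ?thesis by (simp add: parseval card_cube)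
qed

text \<open>For a product kernel each coefficient is a product of two Fourier coefficients. Bounding
  the product by half the sum of squares suffices, as both sums of squares are at most 1.\<close>

lemma spectral_norm_product_le:
  assumes "\<And>x. x \<in> cube N \<Longrightarrow> \<bar>f x\<bar> \<le> 1" "\<And>x. x \<in> cube N \<Longrightarrow> \<bar>g x\<bar> \<le> 1"
  shows "spectral_norm N (\<lambda>x y. f x * g y) \<le> 1"
proof -
  have "corr N S (\<lambda>x y. f x * g y) = fourier N S f * fourier N S g" for S
    by (simp add: corr_def fourier_def sum_product sum_divide_distrib mult_ac
        flip: power_mult_distrib)
  then have "spectral_norm N (\<lambda>x y. f x * g y)
      = (\<Sum>S\<in>Pow {..<N}. \<bar>fourier N S f\<bar> * \<bar>fourier N S g\<bar>)"
    by (simp add: spectral_norm_def abs_mult)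
  also have "\<dots> \<le> (\<Sum>S\<in>Pow {..<N}. ((fourier N S f)\<^sup>2 + (fourier N S g)\<^sup>2) / 2)"
  proof (rule sum_mono)
    fix S
    show "\<bar>fourier N S f\<bar> * \<bar>fourier N S g\<bar> \<le> ((fourier N S f)\<^sup>2 + (fourier N S g)\<^sup>2) / 2"
      using sum_squares_bound[of "\<bar>fourier N S f\<bar>" "\<bar>fourier N S g\<bar>"] by simp
  qed
  also have "\<dots> = ((\<Sum>S\<in>Pow {..<N}. (fourier N S f)\<^sup>2) + (\<Sum>S\<in>Pow {..<N}. (fourier N S g)\<^sup>2)) / 2"
    by (simp add: sum.distrib flip: sum_divide_distrib)
  also have "\<dots> \<le> 1"
    using sum_fourier_square_le[of N f] sum_fourier_square_le[of N g] assms by simp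
  finally show ?thesis .
qed

lemma corr_add: "corr N S (\<lambda>x y. K x y + L x y) = corr N S K + corr N S L"
  by (simp add: corr_def sum.distrib algebra_simps add_divide_distrib)

lemma spectral_norm_add_le:
  "spectral_norm N (\<lambda>x y. K x y + L x y) \<le> spectral_norm N K + spectral_norm N L"
  unfolding spectral_norm_def sum.distrib[symmetric] corr_add
  by (intro sum_mono abs_triangle_ineq)

lemma spectral_norm_zero [simp]: "spectral_norm N (\<lambda>x y. 0) = 0"
  by (simp add: spectral_norm_def corr_def)

text \<open>Fourier inversion: \<open>chi S x * chi S z\<close> is the character at
  \<open>x z\<close>, so orthogonality keeps only the terms with \<open>y = x z\<close>.\<close>

lemma sum_corr_chi:
  assumes z: "z \<in> cube N"
  shows "(\<Sum>S\<in>Pow {..<N}. corr N S K * chi S z) = (\<Sum>x\<in>cube N. K x (map2 (*) x z)) / 2 ^ N"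
proof -
  have "(\<Sum>S\<in>Pow {..<N}. corr N S K * chi S z)
      = (\<Sum>S\<in>Pow {..<N}. \<Sum>x\<in>cube N. \<Sum>y\<in>cube N. K x y * (chi S y * chi S (map2 (*) x z))) / 4 ^ N"
    using z by (simp add: corr_def sum_divide_distrib sum_distrib_right sum_distrib_left chi_mult
        mult_ac)
  also have "(\<Sum>S\<in>Pow {..<N}. \<Sum>x\<in>cube N. \<Sum>y\<in>cube N. K x y * (chi S y * chi S (map2 (*) x z)))
      = (\<Sum>x\<in>cube N. \<Sum>y\<in>cube N. \<Sum>S\<in>Pow {..<N}. K x y * (chi S y * chi S (map2 (*) x z)))"
    by (subst sum.swap, rule sum.cong[OF refl], rule sum.swap)
  also have "\<dots> = (\<Sum>x\<in>cube N. \<Sum>y\<in>cube N. if y = map2 (*) x z then K x y * 2 ^ N else 0)"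
    using z by (intro sum.cong refl) (auto simp: sum_chi_mult cube_mult simp flip: sum_distrib_left)
  also have "\<dots> = (\<Sum>x\<in>cube N. K x (map2 (*) x z)) * 2 ^ N"
    using z by (simp add: sum_distrib_right cube_mult)
  also have "\<dots> / 4 ^ N = (\<Sum>x\<in>cube N. K x (map2 (*) x z)) / 2 ^ N"
    by (simp add: field_simps flip: power_mult_distrib)
  finally show ?thesis .
qed

text \<open>Only the inputs in \<^term>\<open>A \<times> B\<close> are guaranteed to use few bits: branches of the tree that
  no input reaches may be deeper, so the induction has to carry the current rectangle.\<close>
lemma spectral_norm_tree_le:
  fixes v :: "'z \<Rightarrow> real"
  assumes v: "\<And>z. \<bar>v z\<bar> \<le> 1"
    and "\<And>x y. x \<in> A \<Longrightarrow> y \<in> B \<Longrightarrow> tree_bits T (x, ra) (y, rb) \<le> C"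
  shows "spectral_norm N (\<lambda>x y. if x \<in> A \<and> y \<in> B then v (tree_output T (x, ra) (y, rb)) else 0) \<le> 2 ^ C"
  using assms(2)
proof (induction T arbitrary: A B C)
  case (Leaf z)
  let ?f = "\<lambda>x. if x \<in> A then v z else 0" and ?g = "\<lambda>y. if y \<in> B then 1 else 0"
  have "(\<lambda>x y. if x \<in> A \<and> y \<in> B then v (tree_output (Leaf z) (x, ra) (y, rb)) else 0)
      = (\<lambda>x y. ?f x * ?g y)"
    by (auto simp: fun_eq_iff)
  moreover have "spectral_norm N (\<lambda>x y. ?f x * ?g y) \<le> 1"
    using v by (intro spectral_norm_product_le) auto
  ultimately show ?case
    using order_trans[of _ 1 "2 ^ C :: real"] by simp
next
  case (Alice f s t)
  show ?case
  \<comment> \<open>On an empty rectangle the bit bound is vacuous and \<open>C\<close> may be 0.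
    Otherwise an input reaches this node and spends a bit on it, so \<open>C\<close> is a
    successor.\<close>
  proof (cases "A \<times> B = {}")
    case True
    then have "(\<lambda>x y. if x \<in> A \<and> y \<in> B then v (tree_output (Alice f s t) (x, ra) (y, rb)) else 0)
        = (\<lambda>x y. 0)"
      by auto
    then show ?thesis by simp
  next
    case False
    then obtain x y where "x \<in> A" "y \<in> B" by auto
    then obtain C' where C: "C = Suc C'"
      using Alice.prems[of x y] by (cases C) auto
    let ?A1 = "{x \<in> A. f (x, ra)}" and ?A2 = "{x \<in> A. \<not> f (x, ra)}"
    let ?K1 = "\<lambda>x y. if x \<in> ?A1 \<and> y \<in> B then v (tree_output s (x, ra) (y, rb)) else 0"
    let ?K2 = "\<lambda>x y. if x \<in> ?A2 \<and> y \<in> B then v (tree_output t (x, ra) (y, rb)) else 0"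
    have eq: "(\<lambda>x y. if x \<in> A \<and> y \<in> B then v (tree_output (Alice f s t) (x, ra) (y, rb)) else 0)
        = (\<lambda>x y. ?K1 x y + ?K2 x y)"
      by (auto simp: fun_eq_iff)
    have "spectral_norm N ?K1 \<le> 2 ^ C'"
      by (rule Alice.IH(1)) (use Alice.prems C in force)
    moreover have "spectral_norm N ?K2 \<le> 2 ^ C'"
      by (rule Alice.IH(2)) (use Alice.prems C in force)
    ultimately show ?thesis
      unfolding eq using spectral_norm_add_le[of N ?K1 ?K2] C by simp
  qed
next
  case (Bob g s t)
  show ?case
  proof (cases "A \<times> B = {}")
    case True
    then have "(\<lambda>x y. if x \<in> A \<and> y \<in> B then v (tree_output (Bob g s t) (x, ra) (y, rb)) else 0)
        = (\<lambda>x y. 0)"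
      by auto
    then show ?thesis by simp
  next
    case False
    then obtain x y where "x \<in> A" "y \<in> B" by auto
    then obtain C' where C: "C = Suc C'"
      using Bob.prems[of x y] by (cases C) auto
    let ?B1 = "{y \<in> B. g (y, rb)}" and ?B2 = "{y \<in> B. \<not> g (y, rb)}"
    let ?K1 = "\<lambda>x y. if x \<in> A \<and> y \<in> ?B1 then v (tree_output s (x, ra) (y, rb)) else 0"
    let ?K2 = "\<lambda>x y. if x \<in> A \<and> y \<in> ?B2 then v (tree_output t (x, ra) (y, rb)) else 0"
    have eq: "(\<lambda>x y. if x \<in> A \<and> y \<in> B then v (tree_output (Bob g s t) (x, ra) (y, rb)) else 0)
        = (\<lambda>x y. ?K1 x y + ?K2 x y)"
      by (auto simp: fun_eq_iff)
    have "spectral_norm N ?K1 \<le> 2 ^ C'"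
      by (rule Bob.IH(1)) (use Bob.prems C in force)
    moreover have "spectral_norm N ?K2 \<le> 2 ^ C'"
      by (rule Bob.IH(2)) (use Bob.prems C in force)
    ultimately show ?thesis
      unfolding eq using spectral_norm_add_le[of N ?K1 ?K2] C by simp
  qed
qed

section \<open>From deterministic trees to private-coin protocols\<close>

lemma tree_bits_le_size: "tree_bits T a b \<le> size T"
  by (induction T) auto

text \<open>\<open>protocol_cost\<close> is a supremum of naturals, an upper bound only for bounded
  sets; the size of the tree supplies the bound.\<close>

lemma tree_bits_le_protocol_cost:
  assumes "x \<in> X" "y \<in> Y" "ra \<in> set_pmf (alice_coins P)" "rb \<in> set_pmf (bob_coins P)"
  shows "tree_bits (tree P) (x, ra) (y, rb) \<le> protocol_cost X Y P"
  unfolding protocol_cost_def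
  by (rule cSup_upper) (use assms tree_bits_le_size in \<open>auto intro!: bdd_aboveI[of _ "size (tree P)"]\<close>)

text \<open>Fixing both coin strings leaves a deterministic tree, whose spectral norm is bounded.
  The coefficients of the expected output are the expectations of those of the trees, so the bound
  survives.\<close>

lemma protocol_fourier:
  fixes P :: "(int list, int list, int) private_coin_protocol"
  assumes F: "\<And>z. z \<in> cube N \<Longrightarrow> F z \<in> {-1, 1}"
    and succ: "\<And>x y. x \<in> cube N \<Longrightarrow> y \<in> cube N \<Longrightarrow> success_prob P (compose_XOR F) x y \<ge> 1 / 2 + \<epsilon>"
  obtains c :: "nat set \<Rightarrow> real" where
    "(\<Sum>S\<in>Pow {..<N}. \<bar>c S\<bar>) \<le> 2 ^ protocol_cost (cube N) (cube N) P"
    "\<And>z. z \<in> cube N \<Longrightarrow> 2 * \<epsilon> \<le> F z * (\<Sum>S\<in>Pow {..<N}. c S * chi S z)"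
proof -
  define M where "M = pair_pmf (alice_coins P) (bob_coins P)"
  define C where "C = protocol_cost (cube N) (cube N) P"
  \<comment> \<open>A protocol may output any integer. Sending outputs other than -1 and 1 to 0
    keeps \<open>v\<close> bounded by 1 and keeps the indicator of success below
    \<open>(1 + F z * k \<omega> x y) / 2\<close>.\<close>
  define v :: "int \<Rightarrow> real" where "v z = (if z \<in> {-1, 1} then of_int z else 0)" for z
  define k where "k \<omega> x y = v (tree_output (tree P) (x, fst \<omega>) (y, snd \<omega>))" for \<omega> x y
  define K where "K x y = measure_pmf.expectation M (\<lambda>\<omega>. k \<omega> x y)" for x y
  have v1: "\<bar>v z\<bar> \<le> 1" for z by (auto simp: v_def)
  have int: "integrable M (\<lambda>\<omega>. k \<omega> x y)" for x y
    by (rule measure_pmf.integrable_const_bound[where B = 1]) (auto simp: k_def v1)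
  have corrK: "corr N S K = measure_pmf.expectation M (\<lambda>\<omega>. corr N S (k \<omega>))"
    and intc: "integrable M (\<lambda>\<omega>. corr N S (k \<omega>))" for S
    unfolding corr_def K_def by (simp_all add: int)
  have norm_k: "spectral_norm N (k \<omega>) \<le> 2 ^ C" if "\<omega> \<in> set_pmf M" for \<omega>
  proof -
    \<comment> \<open>Coefficients see only points of the cube, so the kernel may be cut down to the
      rectangle on which the cost bounds the number of bits.\<close>
    have "corr N S (k \<omega>) = corr N S (\<lambda>x y. if x \<in> cube N \<and> y \<in> cube N
        then v (tree_output (tree P) (x, fst \<omega>) (y, snd \<omega>)) else 0)" for S
      unfolding corr_def k_def by (intro arg_cong2[where f = "(/)"] sum.cong) auto
    then have "spectral_norm N (k \<omega>) = spectral_norm N (\<lambda>x y. if x \<in> cube N \<and> y \<in> cube N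
        then v (tree_output (tree P) (x, fst \<omega>) (y, snd \<omega>)) else 0)"
      by (simp add: spectral_norm_def)
    also have "\<dots> \<le> 2 ^ C"
      by (rule spectral_norm_tree_le[OF v1])
        (use that in \<open>auto simp: M_def C_def intro: tree_bits_le_protocol_cost\<close>)
    finally show ?thesis .
  qed
  have "(\<Sum>S\<in>Pow {..<N}. \<bar>corr N S K\<bar>)
      \<le> (\<Sum>S\<in>Pow {..<N}. measure_pmf.expectation M (\<lambda>\<omega>. \<bar>corr N S (k \<omega>)\<bar>))"
    unfolding corrK by (intro sum_mono integral_abs_bound)
  also have "\<dots> = measure_pmf.expectation M (\<lambda>\<omega>. spectral_norm N (k \<omega>))"
    unfolding spectral_norm_def using intc by (subst Bochner_Integration.integral_sum) auto
  also have "\<dots> \<le> 2 ^ C"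
    using intc norm_k
    by (intro measure_pmf.integral_le_const) (auto simp: spectral_norm_def AE_measure_pmf_iff)
  finally have 1: "(\<Sum>S\<in>Pow {..<N}. \<bar>corr N S K\<bar>) \<le> 2 ^ C" .
  have adv: "2 * \<epsilon> \<le> F z * K x (map2 (*) x z)" if x: "x \<in> cube N" and z: "z \<in> cube N" for x z
  proof -
    \<comment> \<open>Multiplying by \<open>x\<close> twice is the identity, so every pair
      \<open>(x, x z)\<close> has the same correct answer \<open>F z\<close>.\<close>
    define y where "y = map2 (*) x z"
    have y: "y \<in> cube N" and xy: "compose_XOR F x y = F z"
      using x z by (auto simp: y_def cube_mult compose_XOR_def cube_mult_cancel)
    define E where "E = {\<omega>. tree_output (tree P) (x, fst \<omega>) (y, snd \<omega>) = F z}"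
    have "1 / 2 + \<epsilon> \<le> measure_pmf.prob M E"
      using succ[OF x y] by (simp add: success_prob_def xy M_def E_def case_prod_unfold)
    also have "\<dots> = measure_pmf.expectation M (indicator E)" by simp
    also have "\<dots> \<le> measure_pmf.expectation M (\<lambda>\<omega>. (1 + F z * k \<omega> x y) / 2)"
    proof (rule integral_mono)
      show "integrable M (indicator E :: _ \<Rightarrow> real)"
        by (rule measure_pmf.integrable_const_bound[where B = 1]) (auto simp: indicator_def)
      show "indicator E \<omega> \<le> (1 + F z * k \<omega> x y) / 2" for \<omega>
        using F[OF z] by (auto simp: E_def k_def v_def indicator_def)
    qed (simp add: int)
    also have "\<dots> = (1 + F z * K x y) / 2"
      by (simp add: K_def int)
    finally show ?thesis by (simp add: y_def)
  qed
  have "2 * \<epsilon> \<le> F z * (\<Sum>S\<in>Pow {..<N}. corr N S K * chi S z)" if z: "z \<in> cube N" for z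
  proof -
    have "(\<Sum>x\<in>cube N. 2 * \<epsilon>) \<le> (\<Sum>x\<in>cube N. F z * K x (map2 (*) x z))"
      using adv z by (intro sum_mono)
    then show ?thesis
      unfolding sum_corr_chi[OF z] by (simp add: card_cube field_simps sum_distrib_left)
  qed
  with 1 show ?thesis by (intro that) (simp_all add: C_def)
qed

section \<open>Averages of characters over weight-constrained blocks\<close>

lemma card_supersets:
  assumes "finite A" "U \<subseteq> A" "card U \<le> j"
  shows "card {B. B \<subseteq> A \<and> card B = j \<and> U \<subseteq> B} = (card A - card U) choose (j - card U)"
proof -
  have finU: "finite U" using assms finite_subset by blast
  have "bij_betw (\<lambda>B. B - U) {B. B \<subseteq> A \<and> card B = j \<and> U \<subseteq> B}
          {C. C \<subseteq> A - U \<and> card C = j - card U}"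
  proof (rule bij_betw_byWitness[where f' = "\<lambda>C. C \<union> U"])
    show "(\<lambda>C. C \<union> U) ` {C. C \<subseteq> A - U \<and> card C = j - card U}
        \<subseteq> {B. B \<subseteq> A \<and> card B = j \<and> U \<subseteq> B}"
    proof clarify
      fix C assume C: "C \<subseteq> A - U" "card C = j - card U"
      have "finite C" using C(1) assms(1) by (meson finite_Diff finite_subset)
      then have "card (C \<union> U) = j"
        using C finU assms(3) by (subst card_Un_disjoint) auto
      then show "C \<union> U \<subseteq> A \<and> card (C \<union> U) = j \<and> U \<subseteq> C \<union> U"
        using C assms by auto
    qed
  qed (use finU in \<open>auto simp: card_Diff_subset\<close>)
  then have "card {B. B \<subseteq> A \<and> card B = j \<and> U \<subseteq> B} = card {C. C \<subseteq> A - U \<and> card C = j - card U}"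
    by (rule bij_betw_same_card)
  also have "\<dots> = (card A - card U) choose (j - card U)"
    using assms finU by (simp add: n_subsets card_Diff_subset)
  finally show ?thesis .
qed

definition binomial_poly :: "nat \<Rightarrow> real poly" where
  "binomial_poly u = smult (1 / fact u) (\<Prod>i<u. [:- of_nat i, 1:])"

lemma degree_binomial_poly_le: "degree (binomial_poly u) \<le> u"
  using degree_prod_sum_le[of "{..<u}" "\<lambda>i. [:- of_nat i, 1 :: real:]"]
  by (simp add: binomial_poly_def)

lemma poly_binomial_poly: "poly (binomial_poly u) (real j) = real (j choose u)"
  by (simp add: binomial_poly_def poly_prod binomial_gbinomial gbinomial_prod_rev
      atLeast0LessThan)

text \<open>\<open>q\<close> is a normalised Krawtchouk polynomial; writing each sign as \<open>1 - 2 [l \<in> B]\<close> shows that it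
  is a polynomial in \<open>j\<close>.\<close>
lemma average_character_poly:
  assumes T: "T \<subseteq> {..<m}"
  obtains q :: "real poly" where "degree q \<le> card T"
    "\<And>j. j \<le> m \<Longrightarrow> (\<Sum>B | B \<subseteq> {..<m} \<and> card B = j. \<Prod>l\<in>T. if l \<in> B then -1 else 1 :: real)
       = real (m choose j) * poly q (real j)"
proof -
  \<comment> \<open>A uniform \<open>j\<close>-subset of the \<open>m\<close> blocks contains
    \<open>U\<close> with probability \<open>(j choose card U) / (m choose card U)\<close>; the
    factor \<open>(-2) ^ card U\<close> comes from expanding the signs.\<close>
  define q :: "real poly" where
    "q = (\<Sum>U\<in>Pow T. smult ((-2) ^ card U / real (m choose card U)) (binomial_poly (card U)))"
  have finT: "finite T" using T finite_subset by blast
  have "degree q \<le> card T"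
    unfolding q_def
  proof (rule degree_sum_le)
    fix U assume "U \<in> Pow T"
    then have "card U \<le> card T" using finT by (auto intro: card_mono)
    then show "degree (smult ((-2) ^ card U / real (m choose card U)) (binomial_poly (card U))) \<le> card T"
      by (intro order_trans[OF degree_smult_le] order_trans[OF degree_binomial_poly_le])
  qed (use finT in auto)
  moreover have "(\<Sum>B | B \<subseteq> {..<m} \<and> card B = j. \<Prod>l\<in>T. if l \<in> B then -1 else 1 :: real)
       = real (m choose j) * poly q (real j)" if j: "j \<le> m" for j
  proof -
    let ?L = "{B. B \<subseteq> {..<m} \<and> card B = j}"
    have finL: "finite ?L" by (rule finite_subset[of _ "Pow {..<m}"]) auto
    have "(\<Prod>l\<in>T. if l \<in> B then -1 else 1 :: real)
        = (\<Sum>U\<in>Pow T. if U \<subseteq> B then (-2) ^ card U else 0)" for B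
    proof -
      have "(\<Prod>l\<in>T. if l \<in> B then -1 else 1 :: real) = (\<Prod>l\<in>T. (if l \<in> B then -2 else 0) + 1)"
        by (intro prod.cong) auto
      also have "\<dots> = (\<Sum>U\<in>Pow T. \<Prod>l\<in>U. if l \<in> B then -2 else 0)"
        using finT by (subst prod_add) auto
      also have "\<dots> = (\<Sum>U\<in>Pow T. if U \<subseteq> B then (-2) ^ card U else 0)"
      proof (rule sum.cong[OF refl])
        fix U assume "U \<in> Pow T"
        then have "finite U" using finT finite_subset by blast
        show "(\<Prod>l\<in>U. if l \<in> B then -2 else 0) = (if U \<subseteq> B then (-2) ^ card U else 0 :: real)"
        proof (cases "U \<subseteq> B")
          case True
          then have "(\<Prod>l\<in>U. if l \<in> B then -2 else 0 :: real) = (\<Prod>l\<in>U. -2)"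
            by (intro prod.cong) auto
          then show ?thesis using True by simp
        next
          case False
          then show ?thesis using \<open>finite U\<close> by (auto simp: prod_zero_iff)
        qed
      qed
      finally show ?thesis .
    qed
    then have "(\<Sum>B\<in>?L. \<Prod>l\<in>T. if l \<in> B then -1 else 1 :: real)
        = (\<Sum>U\<in>Pow T. \<Sum>B\<in>?L. if U \<subseteq> B then (-2) ^ card U else 0)"
      by (simp only: sum.swap[of _ "Pow T"])
    also have "\<dots> = (\<Sum>U\<in>Pow T. real (m choose j) *
        ((-2) ^ card U / real (m choose card U) * real (j choose card U)))"
    proof (rule sum.cong[OF refl])
      fix U assume "U \<in> Pow T"
      then have U: "U \<subseteq> {..<m}" using T by auto
      then have u: "card U \<le> m" using card_mono[OF _ U] by simp
      have "(\<Sum>B\<in>?L. if U \<subseteq> B then (-2) ^ card U else 0 :: real)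
          = (-2) ^ card U * real (card {B. B \<subseteq> {..<m} \<and> card B = j \<and> U \<subseteq> B})"
        using finL by (simp add: sum.If_cases Int_def conj_assoc)
      also have "real (card {B. B \<subseteq> {..<m} \<and> card B = j \<and> U \<subseteq> B})
          = real (m choose j) * real (j choose card U) / real (m choose card U)"
      proof (cases "card U \<le> j")
        case True
        have "card {B. B \<subseteq> {..<m} \<and> card B = j \<and> U \<subseteq> B} = (m - card U) choose (j - card U)"
          using card_supersets[OF _ U True] by simp
        moreover have "real (m choose j) * real (j choose card U)
            = real (m choose card U) * real ((m - card U) choose (j - card U))"
          using choose_mult[OF True j] by (metis of_nat_mult)
        ultimately show ?thesis using u by simp
      next
        case False
        have "card U \<le> card B" if "B \<subseteq> {..<m}" "U \<subseteq> B" for B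
          using that by (meson card_mono finite_lessThan finite_subset)
        then have none: "{B. B \<subseteq> {..<m} \<and> card B = j \<and> U \<subseteq> B} = {}" using False by auto
        show ?thesis unfolding none using False by simp
      qed
      finally show "(\<Sum>B\<in>?L. if U \<subseteq> B then (-2) ^ card U else 0 :: real) = real (m choose j) *
        ((-2) ^ card U / real (m choose card U) * real (j choose card U))" by simp
    qed
    also have "\<dots> = real (m choose j) * poly q (real j)"
      by (simp add: q_def poly_sum poly_binomial_poly sum_distrib_left)
    finally show ?thesis .
  qed
  ultimately show ?thesis by (rule that)
qed

text \<open>Each change of \<open>s\<close> forces a root of \<open>q\<close> strictly between
  \<open>j\<close> and \<open>j + 1\<close>; these open intervals are disjoint, so the roots are
  distinct.\<close>

lemma card_sign_changes_le_degree:
  fixes q :: "real poly" and s :: "nat \<Rightarrow> int"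
  assumes pos: "\<And>j. j \<le> m \<Longrightarrow> 0 < s j * poly q (real j)"
    and s: "\<And>j. j \<le> m \<Longrightarrow> s j \<in> {-1, 1}"
  shows "card {j. j < m \<and> s j \<noteq> s (Suc j)} \<le> degree q"
proof -
  let ?J = "{j. j < m \<and> s j \<noteq> s (Suc j)}"
  have "\<exists>x. real j < x \<and> x < real (Suc j) \<and> poly q x = 0" if "j \<in> ?J" for j
  proof -
    have "poly q (real j) * poly q (real (Suc j)) < 0"
      using that pos[of j] pos[of "Suc j"] s[of j] s[of "Suc j"]
      by (auto simp: mult_less_0_iff)
    then show ?thesis using poly_IVT[of "real j" "real (Suc j)" q] by auto
  qed
  then obtain x where x: "\<And>j. j \<in> ?J \<Longrightarrow> real j < x j \<and> x j < real (Suc j) \<and> poly q (x j) = 0"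
    by metis
  have "inj_on x ?J"
  proof (rule inj_onI)
    fix i j assume ij: "i \<in> ?J" "j \<in> ?J" "x i = x j"
    have "real i < real (Suc j)" "real j < real (Suc i)"
      using x[OF ij(1)] x[OF ij(2)] ij(3) by linarith+
    then show "i = j" by linarith
  qed
  moreover have q: "q \<noteq> 0" using pos[of 0] by auto
  ultimately have "card ?J \<le> card {y. poly q y = 0}"
    using x by (intro card_inj_on_le[of x]) (auto simp: poly_roots_finite)
  also have "\<dots> \<le> degree q" using q by (rule card_poly_roots_bound)
  finally show ?thesis .
qed

text \<open>Block \<open>l\<close> has weight 3 if \<open>l \<in> B\<close> and weight 1 otherwise, and \<open>\<sigma> l\<close> is the position of its
  exceptional entry. The \<open>a\<close> coordinates after the blocks shift the total weight.\<close>
definition block_point :: "nat \<Rightarrow> nat \<Rightarrow> nat \<Rightarrow> nat set \<Rightarrow> (nat \<Rightarrow> nat) \<Rightarrow> int list" where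
  "block_point N m a B \<sigma> = map (\<lambda>i.
     if i < 4 * m then (if i div 4 \<in> B then -1 else 1) * (if i mod 4 = \<sigma> (i div 4) then -1 else 1)
     else if i < 4 * m + a then -1 else 1) [0..<N]"

definition block_average :: "nat \<Rightarrow> nat \<Rightarrow> nat \<Rightarrow> nat \<Rightarrow> (int list \<Rightarrow> real) \<Rightarrow> real" where
  "block_average N m a j f =
     (\<Sum>B | B \<subseteq> {..<m} \<and> card B = j. \<Sum>\<sigma>\<in>PiE {..<m} (\<lambda>_. {..<4}). f (block_point N m a B \<sigma>))
     / (real (m choose j) * 4 ^ m)"

section \<open>Weights and characters of the block points\<close>

lemma block_point_cube: "block_point N m a B \<sigma> \<in> cube N"
  by (rule cubeI) (auto simp: block_point_def)

lemma block_point_nth: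
  assumes "l < m" "k < 4" "4 * m \<le> N"
  shows "block_point N m a B \<sigma> ! (4 * l + k)
    = (if l \<in> B then -1 else 1) * (if k = \<sigma> l then -1 else 1)"
  using assms by (simp add: block_point_def)

lemma sum_block: "sum f {l * 4..<l * 4 + 4} = (\<Sum>k<4. f (4 * l + k :: nat))"
  using sum.shift_bounds_nat_ivl[of f 0 "l * 4" 4]
  by (simp add: add.commute mult.commute lessThan_atLeast0)

lemma prod_block: "prod f {l * 4..<l * 4 + 4} = (\<Prod>k<4. f (4 * l + k :: nat))"
  using prod.shift_bounds_nat_ivl[of f 0 "l * 4" 4]
  by (simp add: add.commute mult.commute lessThan_atLeast0)

text \<open>A light block contributes 1 and a heavy one 3, so making one more block heavy raises the
  weight by 2: the step in which the odd-even degree compares values.\<close>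

lemma count_block_point:
  assumes B: "B \<subseteq> {..<m}" and \<sigma>: "\<sigma> \<in> PiE {..<m} (\<lambda>_. {..<4})" and N: "4 * m + a \<le> N"
  shows "count_list (block_point N m a B \<sigma>) (-1) = a + m + 2 * card B"
proof -
  let ?x = "block_point N m a B \<sigma>"
  define f where "f i = (if ?x ! i = -1 then 1 else 0 :: nat)" for i
  have "count_list ?x (-1) = card {i. i < N \<and> ?x ! i = -1}"
    using length_cube[OF block_point_cube[of N m a B \<sigma>]]
    by (simp only: count_list_eq_length_filter length_filter_conv_card eq_commute[of "-1"])
  also have "\<dots> = (\<Sum>i<N. f i)"
    by (simp add: f_def sum.If_cases Int_def)
  also have "{..<N} = {..<m * 4} \<union> {m * 4..<m * 4 + a} \<union> {m * 4 + a..<N}"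
    using N by auto
  also have "(\<Sum>i\<in>\<dots>. f i) = (\<Sum>i<m * 4. f i) + (\<Sum>i=m * 4..<m * 4 + a. f i) + (\<Sum>i=m * 4 + a..<N. f i)"
    by (subst sum.union_disjoint; (subst sum.union_disjoint)?) auto
  also have "(\<Sum>i=m * 4..<m * 4 + a. f i) = (\<Sum>i=m * 4..<m * 4 + a. 1)"
    using N by (intro sum.cong) (auto simp: f_def block_point_def)
  also have "(\<Sum>i=m * 4 + a..<N. f i) = 0"
    using N by (intro sum.neutral) (auto simp: f_def block_point_def)
  also have "(\<Sum>i<m * 4. f i) = (\<Sum>l<m. sum f {l * 4..<l * 4 + 4})"
    by (rule sum.nat_group[symmetric])
  also have "\<dots> = (\<Sum>l<m. 1 + (if l \<in> B then 2 else 0))"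
  proof (rule sum.cong[OF refl])
    fix l assume l: "l \<in> {..<m}"
    then have "\<sigma> l < 4" using \<sigma> by auto
    then have \<sigma>l: "\<sigma> l \<in> {0, 1, 2, 3}" by auto
    \<comment> \<open>The two signs multiply to -1 exactly when one of \<open>l \<in> B\<close> and
      \<open>k = \<sigma> l\<close> holds, hence 0 for the equivalence.\<close>
    have "sum f {l * 4..<l * 4 + 4} = (\<Sum>k<4. if l \<in> B \<longleftrightarrow> k = \<sigma> l then 0 else 1)"
      unfolding sum_block using N l by (intro sum.cong) (auto simp: f_def block_point_nth)
    also have "\<dots> = (\<Sum>k\<in>{0, 1, 2, 3}. if l \<in> B \<longleftrightarrow> k = \<sigma> l then 0 else 1)"
      by (intro sum.cong) auto
    also have "\<dots> = 1 + (if l \<in> B then 2 else 0)"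
      using \<sigma>l by (cases "l \<in> B") auto
    finally show "sum f {l * 4..<l * 4 + 4} = 1 + (if l \<in> B then 2 else 0)" .
  qed
  also have "\<dots> = m + 2 * card B"
    using B by (simp add: sum_Suc sum.If_cases Int_absorb1)
  finally show ?thesis by simp
qed

lemma symmetric_block_point:
  assumes "symmetric_on_cube N F" "B \<subseteq> {..<m}" "\<sigma> \<in> PiE {..<m} (\<lambda>_. {..<4})" "4 * m + a \<le> N"
  shows "F (block_point N m a B \<sigma>) = symm_predicate N F (a + m + 2 * card B)"
proof -
  let ?i = "a + m + 2 * card B"
  have "card B \<le> m" using assms(2) card_mono[of "{..<m}" B] by simp
  then have "?i \<le> N" using assms(4) by simp
  then have "replicate ?i (-1) @ replicate (N - ?i) 1 \<in> cube N" by (auto simp: cube_def)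
  moreover have "count_list (replicate k y) x = (if x = y then k else 0)" for k and x y :: int
    by (induction k) auto
  then have "count_list (replicate ?i (-1) @ replicate (N - ?i) 1) (-1 :: int) = ?i"
    by (simp only: count_list_append) simp
  ultimately show ?thesis
    using assms(1) block_point_cube[of N m a B \<sigma>] count_block_point[OF assms(2-4)]
    unfolding symmetric_on_cube_def symm_predicate_def by metis
qed

text \<open>Here \<open>t\<close> is the number of blocks that \<open>S\<close> meets in an odd
  number of positions. Only these feel the choice of \<open>B\<close>, which gives the degree bound;
  averaging over the exceptional position gains a factor 1/2 on each, which gives the decay.\<close>

lemma block_average_character:
  assumes S: "S \<subseteq> {..<N}" and N: "4 * m \<le> N"
  obtains t and q :: "real poly" where "degree q \<le> t"
    "\<And>j. j \<le> m \<Longrightarrow> block_average N m a j (chi S) = poly q (real j)"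
    "\<And>j. j \<le> m \<Longrightarrow> \<bar>block_average N m a j (chi S)\<bar> \<le> 1 / 2 ^ t"
proof -
  define rest :: real where
    "rest = (\<Prod>i=m*4..<N. if i \<in> S then (if i < 4 * m + a then -1 else 1) else 1)"
  define w :: "nat \<Rightarrow> nat \<Rightarrow> real" where
    "w l v = (\<Prod>k<4. if 4 * l + k \<in> S \<and> k = v then -1 else 1)" for l v
  \<comment> \<open>The nested inequalities express odd parity of the four memberships in block
    \<open>l\<close>.\<close>
  define T where "T = {l. l < m \<and> ((4 * l \<in> S) \<noteq> (4 * l + 1 \<in> S)) \<noteq> ((4 * l + 2 \<in> S) \<noteq> (4 * l + 3 \<in> S))}"
  define \<phi> where "\<phi> l = (\<Sum>v<4. w l v) / 4" for l
  have four: "{..<4} = {0, 1, 2, 3 :: nat}" by auto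
  have T: "T \<subseteq> {..<m}" by (auto simp: T_def)
  have rest: "\<bar>rest\<bar> = 1"
    unfolding rest_def abs_prod by (intro prod.neutral) auto
  have chi_eq: "chi S (block_point N m a B \<sigma>)
      = rest * (\<Prod>l\<in>T. if l \<in> B then -1 else 1) * (\<Prod>l<m. w l (\<sigma> l))"
    if \<sigma>: "\<sigma> \<in> PiE {..<m} (\<lambda>_. {..<4})" for B \<sigma>
  proof -
    define f where "f i = (if i \<in> S then real_of_int (block_point N m a B \<sigma> ! i) else 1)" for i
    have "chi S (block_point N m a B \<sigma>) = (\<Prod>i<N. f i)"
      unfolding chi_def f_def using S by (intro prod.mono_neutral_cong_left) auto
    also have "{..<N} = {..<m * 4} \<union> {m * 4..<N}" using N by auto
    also have "(\<Prod>i\<in>\<dots>. f i) = (\<Prod>i<m * 4. f i) * (\<Prod>i=m * 4..<N. f i)"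
      by (subst prod.union_disjoint) auto
    also have "(\<Prod>i=m * 4..<N. f i) = rest"
      unfolding rest_def by (intro prod.cong) (auto simp: f_def block_point_def)
    also have "(\<Prod>i<m * 4. f i) = (\<Prod>l<m. prod f {l * 4..<l * 4 + 4})"
      by (rule prod.nat_group[symmetric])
    also have "\<dots> = (\<Prod>l<m. (if l \<in> T then (if l \<in> B then -1 else 1) else 1) * w l (\<sigma> l))"
    proof (rule prod.cong[OF refl])
      fix l assume l: "l \<in> {..<m}"
      have "prod f {l * 4..<l * 4 + 4} = (\<Prod>k<4. (if 4 * l + k \<in> S \<and> l \<in> B then -1 else 1)
          * (if 4 * l + k \<in> S \<and> k = \<sigma> l then -1 else 1))"
        unfolding prod_block using N l by (intro prod.cong) (auto simp: f_def block_point_nth)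
      also have "\<dots> = (\<Prod>k<4. if 4 * l + k \<in> S \<and> l \<in> B then -1 else 1) * w l (\<sigma> l)"
        by (simp add: w_def prod.distrib)
      also have "(\<Prod>k<4. if 4 * l + k \<in> S \<and> l \<in> B then -1 else 1 :: real)
          = (if l \<in> T then (if l \<in> B then -1 else 1) else 1)"
        using l unfolding four by (cases "l \<in> B") (simp_all add: T_def)
      finally show "prod f {l * 4..<l * 4 + 4} = (if l \<in> T then (if l \<in> B then -1 else 1) else 1) * w l (\<sigma> l)" .
    qed
    also have "\<dots> = (\<Prod>l\<in>T. if l \<in> B then -1 else 1) * (\<Prod>l<m. w l (\<sigma> l))"
      unfolding prod.distrib using T
      by (intro arg_cong2[where f = "(*)"] prod.mono_neutral_cong_right) auto
    finally show ?thesis by (simp add: mult_ac)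
  qed
  obtain q0 where q0: "degree q0 \<le> card T"
    "\<And>j. j \<le> m \<Longrightarrow> (\<Sum>B | B \<subseteq> {..<m} \<and> card B = j. \<Prod>l\<in>T. if l \<in> B then -1 else 1)
       = real (m choose j) * poly q0 (real j)"
    using average_character_poly[OF T] by blast
  define q where "q = smult (rest * (\<Prod>l<m. \<phi> l)) q0"
  have avg: "block_average N m a j (chi S) = poly q (real j)" if j: "j \<le> m" for j
  proof -
    have "(\<Sum>B | B \<subseteq> {..<m} \<and> card B = j. \<Sum>\<sigma>\<in>PiE {..<m} (\<lambda>_. {..<4}). chi S (block_point N m a B \<sigma>))
        = (\<Sum>B | B \<subseteq> {..<m} \<and> card B = j. rest * (\<Prod>l\<in>T. if l \<in> B then -1 else 1)
             * (\<Sum>\<sigma>\<in>PiE {..<m} (\<lambda>_. {..<4}). \<Prod>l<m. w l (\<sigma> l)))"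
      by (intro sum.cong refl) (simp add: chi_eq sum_distrib_left)
    also have "(\<Sum>\<sigma>\<in>PiE {..<m} (\<lambda>_. {..<4}). \<Prod>l<m. w l (\<sigma> l)) = (\<Prod>l<m. \<Sum>v<4. w l v)"
      by (rule prod_sum_PiE[symmetric]) auto
    also have "\<dots> = 4 ^ m * (\<Prod>l<m. \<phi> l)"
      by (simp add: \<phi>_def prod_dividef)
    finally show ?thesis
      using j by (simp add: block_average_def q_def q0(2) flip: sum_distrib_left sum_distrib_right)
  qed
  \<comment> \<open>If \<open>S\<close> has \<open>k\<close> positions in block \<open>l\<close>,
    then \<open>\<phi> l = 1 - k / 2\<close>, which is 1/2 or -1/2 for odd \<open>k\<close>.\<close>
  have \<phi>: "\<bar>\<phi> l\<bar> \<le> (if l \<in> T then 1 / 2 else 1)" if "l < m" for l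
    using that by (simp add: \<phi>_def w_def T_def four)
  have "\<bar>\<Prod>l<m. \<phi> l\<bar> \<le> (\<Prod>l<m. if l \<in> T then 1 / 2 else 1)"
    unfolding abs_prod using \<phi> by (intro prod_mono) auto
  also have "\<dots> = (\<Prod>l\<in>T. 1 / 2)"
    using T by (intro prod.mono_neutral_cong_right) auto
  finally have \<phi>_le: "\<bar>\<Prod>l<m. \<phi> l\<bar> \<le> 1 / 2 ^ card T"
    by (simp add: power_one_over)
  have "\<bar>block_average N m a j (chi S)\<bar> \<le> 1 / 2 ^ card T" if j: "j \<le> m" for j
  proof -
    have "\<bar>real (m choose j) * poly q0 (real j)\<bar>
        \<le> (\<Sum>B | B \<subseteq> {..<m} \<and> card B = j. \<bar>\<Prod>l\<in>T. if l \<in> B then -1 else 1 :: real\<bar>)"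
      unfolding q0(2)[OF j, symmetric] by (rule sum_abs)
    also have "\<dots> = (\<Sum>B | B \<subseteq> {..<m} \<and> card B = j. 1)"
      unfolding abs_prod by (intro sum.cong prod.neutral refl) auto
    also have "\<dots> = real (m choose j)" by (simp add: n_subsets)
    finally have "\<bar>poly q0 (real j)\<bar> \<le> 1"
      using j by (simp add: abs_mult)
    then have "\<bar>\<Prod>l<m. \<phi> l\<bar> * \<bar>poly q0 (real j)\<bar> \<le> 1 / 2 ^ card T * 1"
      using \<phi>_le by (intro mult_mono) auto
    then show ?thesis using rest j by (simp add: avg q_def abs_mult)
  qed
  moreover have "degree q \<le> card T"
    unfolding q_def by (intro order_trans[OF degree_smult_le] q0(1))
  ultimately show ?thesis using avg that by blast
qed

text \<open>With a larger margin, the characters with \<open>t S \<ge> W\<close> would be too small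
  on average to affect the sign. The remaining ones would form a polynomial of degree below
  \<open>W\<close> with \<open>W\<close> sign changes.\<close>

lemma margin_le_of_sign_changes:
  assumes F: "\<And>z. z \<in> cube N \<Longrightarrow> F z \<in> {-1, 1 :: int}"
    and sym: "symmetric_on_cube N F"
    and c: "(\<Sum>S\<in>Pow {..<N}. \<bar>c S\<bar>) \<le> w"
    and margin: "\<And>z. z \<in> cube N \<Longrightarrow> \<delta> \<le> F z * (\<Sum>S\<in>Pow {..<N}. c S * chi S z)"
    and s: "m \<le> s" "s + 3 * m \<le> N"
  shows "\<delta> \<le> w / 2 ^ card {j. j < m \<and> symm_predicate N F (s + 2 * j) \<noteq> symm_predicate N F (s + 2 * Suc j)}"
proof (rule ccontr)
  define D where "D j = symm_predicate N F (s + 2 * j)" for j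
  define W where "W = card {j. j < m \<and> D j \<noteq> D (Suc j)}"
  \<comment> \<open>With all blocks light the weight is \<open>a + m\<close>, which has to be
    \<open>s\<close>. The conditions on \<open>s\<close> say that \<open>a\<close> is a true
    difference and that \<open>4 * m + a\<close> coordinates fit into \<open>N\<close>.\<close>
  define a where "a = s - m"
  assume "\<not> ?thesis"
  then have \<delta>: "w / 2 ^ W < \<delta>" by (simp add: W_def D_def)
  have N: "4 * m + a \<le> N" "4 * m \<le> N" and sa: "a + m = s" using s by (auto simp: a_def)
  have "\<exists>t q. degree (q :: real poly) \<le> t
      \<and> (\<forall>j\<le>m. block_average N m a j (chi S) = poly q (real j))
      \<and> (\<forall>j\<le>m. \<bar>block_average N m a j (chi S)\<bar> \<le> 1 / 2 ^ t)" if "S \<subseteq> {..<N}" for S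
    using block_average_character[OF that N(2), of a] by metis
  then obtain t and q :: "nat set \<Rightarrow> real poly" where
    deg: "\<And>S. S \<subseteq> {..<N} \<Longrightarrow> degree (q S) \<le> t S" and
    avg: "\<And>S j. S \<subseteq> {..<N} \<Longrightarrow> j \<le> m \<Longrightarrow> block_average N m a j (chi S) = poly (q S) (real j)" and
    small: "\<And>S j. S \<subseteq> {..<N} \<Longrightarrow> j \<le> m \<Longrightarrow> \<bar>block_average N m a j (chi S)\<bar> \<le> 1 / 2 ^ t S"
    by metis
  define Q where "Q = (\<Sum>S\<in>{S \<in> Pow {..<N}. t S < W}. smult (c S) (q S))"
  have D: "D j \<in> {-1, 1}" if "j \<le> m" for j
  proof -
    have "replicate (s + 2 * j) (-1) @ replicate (N - (s + 2 * j)) 1 \<in> cube N"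
      using that s by (auto simp: cube_def)
    then show ?thesis unfolding D_def symm_predicate_def by (rule F)
  qed
  have pos: "0 < D j * poly Q (real j)" if j: "j \<le> m" for j
  proof -
    let ?L = "{B. B \<subseteq> {..<m} \<and> card B = j}" and ?E = "PiE {..<m} (\<lambda>_. {..<4::nat})"
    let ?p = "\<lambda>z. \<Sum>S\<in>Pow {..<N}. c S * chi S z"
    let ?avg = "block_average N m a j"
    have card_E: "card ?E = 4 ^ m" by (simp add: card_PiE)
    \<comment> \<open>Average the margin over all points with \<open>j\<close> heavy blocks; they
      share one weight, so \<open>F\<close> is constantly \<open>D j\<close> there.\<close>
    have "(\<Sum>B\<in>?L. \<Sum>\<sigma>\<in>?E. \<delta>) \<le> (\<Sum>B\<in>?L. \<Sum>\<sigma>\<in>?E. D j * ?p (block_point N m a B \<sigma>))"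
    proof (intro sum_mono)
      fix B \<sigma> assume B: "B \<in> ?L" and \<sigma>: "\<sigma> \<in> ?E"
      have "F (block_point N m a B \<sigma>) = D j"
        using symmetric_block_point[OF sym _ \<sigma> N(1), of B] B sa by (simp add: D_def)
      with margin[OF block_point_cube[of N m a B \<sigma>]]
      show "\<delta> \<le> D j * ?p (block_point N m a B \<sigma>)" by simp
    qed
    then have "real (m choose j) * 4 ^ m * \<delta>
        \<le> D j * (\<Sum>B\<in>?L. \<Sum>\<sigma>\<in>?E. ?p (block_point N m a B \<sigma>))"
      by (simp add: n_subsets card_E sum_distrib_left)
    then have "\<delta> \<le> D j * ?avg ?p"
      using j by (simp add: block_average_def field_simps)
    also have "?avg ?p = (\<Sum>S\<in>Pow {..<N}. c S * ?avg (chi S))"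
    proof -
      have "(\<Sum>B\<in>?L. \<Sum>\<sigma>\<in>?E. ?p (block_point N m a B \<sigma>))
          = (\<Sum>S\<in>Pow {..<N}. \<Sum>B\<in>?L. \<Sum>\<sigma>\<in>?E. c S * chi S (block_point N m a B \<sigma>))"
        by (simp only: sum.swap[of _ "Pow {..<N}"])
      then show ?thesis
        by (simp add: block_average_def sum_divide_distrib sum_distrib_left)
    qed
    also have "\<dots> = (\<Sum>S\<in>{S \<in> Pow {..<N}. t S < W}. c S * ?avg (chi S))
        + (\<Sum>S\<in>{S \<in> Pow {..<N}. \<not> t S < W}. c S * ?avg (chi S))"
      by (subst sum.union_disjoint[symmetric]) (auto intro!: sum.cong)
    also have "(\<Sum>S\<in>{S \<in> Pow {..<N}. t S < W}. c S * ?avg (chi S)) = poly Q (real j)"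
      using j by (auto simp: Q_def poly_sum avg intro!: sum.cong)
    finally have "\<delta> \<le> D j * (poly Q (real j) + (\<Sum>S\<in>{S \<in> Pow {..<N}. \<not> t S < W}. c S * ?avg (chi S)))" .
    moreover have "\<bar>\<Sum>S\<in>{S \<in> Pow {..<N}. \<not> t S < W}. c S * ?avg (chi S)\<bar> \<le> w / 2 ^ W"
    proof -
      have "\<bar>\<Sum>S\<in>{S \<in> Pow {..<N}. \<not> t S < W}. c S * ?avg (chi S)\<bar>
          \<le> (\<Sum>S\<in>{S \<in> Pow {..<N}. \<not> t S < W}. \<bar>c S\<bar> * (1 / 2 ^ W))"
      proof (rule order_trans[OF sum_abs], rule sum_mono)
        fix S assume S: "S \<in> {S \<in> Pow {..<N}. \<not> t S < W}"
        have "\<bar>?avg (chi S)\<bar> \<le> 1 / 2 ^ t S" using small S j by auto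
        also have "\<dots> \<le> 1 / 2 ^ W" using S by (intro divide_left_mono power_increasing) auto
        finally show "\<bar>c S * ?avg (chi S)\<bar> \<le> \<bar>c S\<bar> * (1 / 2 ^ W)"
          unfolding abs_mult by (intro mult_left_mono) auto
      qed
      also have "\<dots> \<le> (\<Sum>S\<in>Pow {..<N}. \<bar>c S\<bar> * (1 / 2 ^ W))"
        by (intro sum_mono2) auto
      also have "\<dots> \<le> w * (1 / 2 ^ W)"
        unfolding sum_distrib_right[symmetric] using c by (intro mult_right_mono) auto
      finally show ?thesis by simp
    qed
    ultimately show ?thesis
      using \<delta> D[OF j] by auto
  qed
  have le: "W \<le> degree Q"
    using card_sign_changes_le_degree[OF pos D] by (simp add: W_def)
  show False
  \<comment> \<open>For \<open>W = 0\<close> no character is low, so \<open>Q\<close> is the zero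
    polynomial and cannot have a sign; a degree strictly below \<open>W\<close> makes sense only for
    positive \<open>W\<close>.\<close>
  proof (cases "W = 0")
    case True
    then have "Q = 0" by (simp add: Q_def)
    then show False using pos[of 0] by simp
  next
    case False
    have "degree Q < W"
      unfolding Q_def
    proof (rule degree_sum_less)
      fix S assume "S \<in> {S \<in> Pow {..<N}. t S < W}"
      then show "degree (smult (c S) (q S)) < W"
        using deg[of S] degree_smult_le[of "c S" "q S"] by auto
    qed (use False in auto)
    with le show False by simp
  qed
qed

section \<open>The lower bound\<close>

text \<open>Taking logarithms in \<open>2 * \<epsilon> \<le> 2 ^ C / 2 ^ W\<close> bounds
  \<open>W\<close> by \<open>C + log 2 (1 / \<epsilon>)\<close>, for every advantage
  \<open>\<epsilon>\<close> at once.\<close>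

lemma PP_ge_sign_changes:
  assumes F: "\<And>z. z \<in> cube N \<Longrightarrow> F z \<in> {-1, 1 :: int}"
    and sym: "symmetric_on_cube N F"
    and s: "m \<le> s" "s + 3 * m \<le> N"
  shows "PP_cc (cube N) (cube N) (compose_XOR F)
    \<ge> ereal (card {j. j < m \<and> symm_predicate N F (s + 2 * j) \<noteq> symm_predicate N F (s + 2 * Suc j)})"
    (is "_ \<ge> ereal (real ?W)")
  unfolding PP_cc_def
proof (rule INF_greatest)
  fix \<epsilon> :: real
  assume "\<epsilon> \<in> {0<..}"
  then have \<epsilon>: "\<epsilon> > 0" by simp
  let ?G = "compose_XOR F"
  let ?Ps = "{P. \<forall>x\<in>cube N. \<forall>y\<in>cube N. success_prob P ?G x y \<ge> 1 / 2 + \<epsilon>}"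
  let ?costs = "(\<lambda>P. enat (protocol_cost (cube N) (cube N) P)) ` ?Ps"
  show "ereal (real ?W) \<le> ereal_of_enat (rand_cc (cube N) (cube N) \<epsilon> ?G) + ereal (log 2 (1 / \<epsilon>))"
  proof (cases "?Ps = {}")
    case True
    then have "rand_cc (cube N) (cube N) \<epsilon> ?G = \<infinity>"
      unfolding rand_cc_def True by (simp add: top_enat_def)
    then show ?thesis by simp
  next
    case False
    then obtain k where k: "k \<in> ?costs" by blast
    then have "?costs \<noteq> {}" by blast
    \<comment> \<open>A nonempty infimum of extended naturals is attained, so an actual protocol
      realises \<open>rand_cc\<close>.\<close>
    then have "Inf ?costs = (LEAST k. k \<in> ?costs)" by (simp only: Inf_enat_def if_False)
    then have "Inf ?costs \<in> ?costs" using LeastI[of "\<lambda>k. k \<in> ?costs", OF k] by simp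
    then obtain P where P: "P \<in> ?Ps"
      and R: "rand_cc (cube N) (cube N) \<epsilon> ?G = enat (protocol_cost (cube N) (cube N) P)"
      unfolding rand_cc_def by (metis (no_types, lifting) imageE)
    let ?C = "protocol_cost (cube N) (cube N) P"
    obtain c where c: "(\<Sum>S\<in>Pow {..<N}. \<bar>c S\<bar>) \<le> 2 ^ ?C"
      "\<And>z. z \<in> cube N \<Longrightarrow> 2 * \<epsilon> \<le> F z * (\<Sum>S\<in>Pow {..<N}. c S * chi S z)"
      using protocol_fourier[of N F \<epsilon> P] F P by blast
    have "real W \<le> real C + log 2 (1 / \<epsilon>)" if "2 * \<epsilon> \<le> 2 ^ C / 2 ^ W" for W C
    proof -
      have "2 ^ W * \<epsilon> \<le> 2 ^ W * (2 * \<epsilon>)" using \<epsilon> by simp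
      also have "\<dots> \<le> 2 ^ C" using that by (simp add: field_simps)
      finally have "log 2 (2 ^ W * \<epsilon>) \<le> log 2 (2 ^ C)"
        using \<epsilon> by (intro log_mono) auto
      then show ?thesis using \<epsilon> by (simp add: log_mult log_divide)
    qed
    from this[OF margin_le_of_sign_changes[OF F sym c s]] show ?thesis by (simp add: R)
  qed
qed

section \<open>Covering the range of weights by windows\<close>

text \<open>A window moves in steps of 2 and sees one parity only; a second window, starting at
  \<open>s + 1\<close>, sees the other.\<close>

lemma card_window_le:
  fixes w :: real and N :: nat
  assumes window: "\<And>m s. m \<le> s \<Longrightarrow> s + 3 * m \<le> N \<Longrightarrow> card {j. j < m \<and> ch (s + 2 * j)} \<le> w"
    and s: "1 \<le> m" "m \<le> s" "s + 3 * m \<le> N"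
  shows "card {i. s \<le> i \<and> i + 1 < s + 2 * m \<and> ch i} \<le> 2 * w"
proof -
  \<comment> \<open>The shifted window has one block fewer: \<open>s + 1 + 3 * (m - 1)\<close> stays
    within \<open>N\<close>, and it still reaches every \<open>i\<close> with
    \<open>i + 1 < s + 2 * m\<close>.\<close>
  let ?A = "{j. j < m \<and> ch (s + 2 * j)}" and ?B = "{j. j < m - 1 \<and> ch (s + 1 + 2 * j)}"
  have "{i. s \<le> i \<and> i + 1 < s + 2 * m \<and> ch i} \<subseteq> (\<lambda>j. s + 2 * j) ` ?A \<union> (\<lambda>j. s + 1 + 2 * j) ` ?B"
  proof
    fix i assume "i \<in> {i. s \<le> i \<and> i + 1 < s + 2 * m \<and> ch i}"
    then have i: "s \<le> i" "i + 1 < s + 2 * m" "ch i" by auto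
    define j where "j = (i - s) div 2"
    have "i = s + 2 * j \<or> i = s + 1 + 2 * j" using i(1) unfolding j_def by presburger
    then show "i \<in> (\<lambda>j. s + 2 * j) ` ?A \<union> (\<lambda>j. s + 1 + 2 * j) ` ?B"
    proof
      assume e: "i = s + 2 * j"
      with i have "j \<in> ?A" by auto
      with e show ?thesis by blast
    next
      assume e: "i = s + 1 + 2 * j"
      with i have "j \<in> ?B" by auto
      with e show ?thesis by blast
    qed
  qed
  then have "card {i. s \<le> i \<and> i + 1 < s + 2 * m \<and> ch i}
      \<le> card ((\<lambda>j. s + 2 * j) ` ?A \<union> (\<lambda>j. s + 1 + 2 * j) ` ?B)"
    by (rule card_mono[rotated]) simp
  also have "\<dots> \<le> card ?A + card ?B"
    by (rule order_trans[OF card_Un_le add_mono]) (simp_all add: card_image_le)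
  finally have "real (card {i. s \<le> i \<and> i + 1 < s + 2 * m \<and> ch i}) \<le> card ?A + card ?B"
    by linarith
  moreover have "card ?A \<le> w" using s by (intro window)
  moreover have "card ?B \<le> w" using s by (intro window) auto
  ultimately show ?thesis by linarith
qed

text \<open>The range left uncovered at each end has length about \<open>m\<close>. Halving
  \<open>m\<close> costs one window on the left and one on the right, each holding at most
  \<open>2 * w\<close> changes; the \<open>+ 1\<close> in the bound on \<open>m\<close> absorbs the
  rounding.\<close>

lemma card_le_dyadic_windows:
  fixes w :: real and n :: nat and ch :: "nat \<Rightarrow> bool"
  assumes n: "n \<ge> 1"
    and window: "\<And>m s. m \<le> s \<Longrightarrow> s + 3 * m \<le> 4 * n \<Longrightarrow> card {j. j < m \<and> ch (s + 2 * j)} \<le> w"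
  shows "\<exists>m\<ge>1. m \<le> n \<and> real m \<le> real n / 2 ^ K + 1
    \<and> card {i. m \<le> i \<and> i + m + 2 \<le> 4 * n \<and> ch i} \<le> 4 * w * real (K + 1)"
proof (induction K)
  case 0
  have w: "w \<ge> 0" using window[of 0 0] by simp
  have "{i. n \<le> i \<and> i + n + 2 \<le> 4 * n \<and> ch i} = {i. n \<le> i \<and> i + 1 < n + 2 * n \<and> ch i}"
    by auto
  moreover have "card {i. n \<le> i \<and> i + 1 < n + 2 * n \<and> ch i} \<le> 2 * w"
    by (rule card_window_le[OF window]) (use n in auto)
  ultimately show ?case using n w by (intro exI[of _ n]) auto
next
  case (Suc K)
  then obtain m where m: "1 \<le> m" "m \<le> n" "real m \<le> n / 2 ^ K + 1"
    "card {i. m \<le> i \<and> i + m + 2 \<le> 4 * n \<and> ch i} \<le> 4 * w * real (K + 1)" by blast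
  \<comment> \<open>Rounding up gives \<open>m \<le> 2 * m'\<close>, so the new windows, which
    extend to distance about \<open>3 * m'\<close> from the ends, leave no gap to the part already
    covered.\<close>
  define m' where "m' = (m + 1) div 2"
  have m': "1 \<le> m'" "m' \<le> n" "m \<le> 2 * m'" "2 * m' \<le> m + 1"
    using m(1,2) by (auto simp: m'_def)
  let ?M = "{i. m \<le> i \<and> i + m + 2 \<le> 4 * n \<and> ch i}"
  let ?L = "{i. m' \<le> i \<and> i + 1 < m' + 2 * m' \<and> ch i}"
  let ?R = "{i. 4 * n - 3 * m' \<le> i \<and> i + 1 < 4 * n - 3 * m' + 2 * m' \<and> ch i}"
  have fin: "finite (?M \<union> ?L \<union> ?R)"
    by (rule finite_subset[of _ "{..4 * n + 3 * m'}"]) auto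
  have "{i. m' \<le> i \<and> i + m' + 2 \<le> 4 * n \<and> ch i} \<subseteq> ?M \<union> ?L \<union> ?R"
    using m m' by auto
  then have "card {i. m' \<le> i \<and> i + m' + 2 \<le> 4 * n \<and> ch i} \<le> card (?M \<union> ?L \<union> ?R)"
    using fin by (rule card_mono[rotated])
  also have "\<dots> \<le> card ?M + card ?L + card ?R"
    by (intro order_trans[OF card_Un_le] add_right_mono card_Un_le)
  finally have "real (card {i. m' \<le> i \<and> i + m' + 2 \<le> 4 * n \<and> ch i}) \<le> card ?M + card ?L + card ?R"
    by linarith
  moreover have "card ?L \<le> 2 * w"
    by (rule card_window_le[OF window]) (use m' in auto)
  moreover have "card ?R \<le> 2 * w"
    by (rule card_window_le[OF window]) (use m' in auto)
  ultimately have "card {i. m' \<le> i \<and> i + m' + 2 \<le> 4 * n \<and> ch i} \<le> 4 * w * real (Suc K + 1)"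
    using m(4) by (simp add: algebra_simps)
  moreover have "real m' \<le> n / 2 ^ Suc K + 1"
  proof -
    have "real m' \<le> (real m + 1) / 2" using of_nat_mono[OF m'(4), where 'a = real] by simp
    also have "\<dots> \<le> (real n / 2 ^ K + 1 + 1) / 2" using m(3) by (intro divide_right_mono) auto
    also have "\<dots> = real n / 2 ^ Suc K + 1" by (simp add: field_simps)
    finally show ?thesis .
  qed
  ultimately show ?case using m' by (intro exI[of _ m']) simp
qed

text \<open>If \<open>PP\<close> is a real \<open>w\<close>, no window holds more than
  \<open>w\<close> changes, and the dyadic covering turns this into an upper bound on
  \<open>r\<close>.\<close>

theorem mainTheorem5:
  "\<exists>c::real. c > 0 \<and>
     (\<forall>(n::nat) (F :: int list \<Rightarrow> int) (r::nat).
        (\<forall>x\<in>cube (4 * n). F x \<in> {-1, 1}) \<longrightarrow>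
        symmetric_on_cube (4 * n) F \<longrightarrow>
        r = odd_even_degree (4 * n) F \<longrightarrow>
        r \<ge> 4 \<longrightarrow>
        PP_cc (cube (4 * n)) (cube (4 * n)) (compose_XOR F)
          \<ge> ereal (c * real r / max 1 (log 2 (real n / real r))))"
\<comment> \<open>The constant is 1 / (4 * 4 * 6): \<open>r\<close> is at most 4 times the covered
  changes, each scale contributes \<open>4 * w\<close>, and \<open>K + 1\<close> is at most
  \<open>6 * L\<close>.\<close>
proof (intro exI[of _ "1 / 96"] conjI allI impI)
  fix n r :: nat and F :: "int list \<Rightarrow> int"
  assume F: "\<forall>x\<in>cube (4 * n). F x \<in> {-1, 1}" and sym: "symmetric_on_cube (4 * n) F"
    and r: "r = odd_even_degree (4 * n) F" and r4: "r \<ge> 4"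
  define L where "L = max 1 (log 2 (real n / real r))"
  define ch where "ch i \<longleftrightarrow> symm_predicate (4 * n) F i \<noteq> symm_predicate (4 * n) F (i + 2)" for i
  define PP where "PP = PP_cc (cube (4 * n)) (cube (4 * n)) (compose_XOR F)"
  have window: "ereal (card {j. j < m \<and> ch (s + 2 * j)}) \<le> PP" if "m \<le> s" "s + 3 * m \<le> 4 * n" for m s
    using PP_ge_sign_changes[OF _ sym that] F by (simp add: ch_def PP_def add_ac)
  have r_eq: "r = card {i \<in> {0..4 * n - 2}. ch i}"
    by (simp add: r odd_even_degree_def ch_def)
  have n: "n \<ge> 1"
  \<comment> \<open>For \<open>n = 0\<close> truncated subtraction makes the index range
    \<open>{0}\<close>, so \<open>r\<close> would be at most 1.\<close>
  proof (rule ccontr)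
    assume "\<not> n \<ge> 1"
    then have "r \<le> card {0 :: nat}" unfolding r_eq by (intro card_mono) auto
    then show False using r4 by simp
  qed
  have "ereal (1 / 96 * real r / L) \<le> PP"
  proof (cases PP)
    case PInf
    then show ?thesis by simp
  next
    case MInf
    then show ?thesis using window[of 0 0] by simp
  next
    case (real w)
    \<comment> \<open>Chosen so that \<open>n / 2 ^ K \<le> r / 8\<close>, hence
      \<open>m \<le> r / 8 + 1\<close>. The two uncovered ends then hold at most
      \<open>r / 4 + 2\<close> changes, which is at most \<open>3 * r / 4\<close> because
      \<open>r \<ge> 4\<close>.\<close>
    define K where "K = nat \<lceil>log 2 (8 * real n / real r)\<rceil>"
    have "\<exists>m\<ge>1. m \<le> n \<and> real m \<le> real n / 2 ^ K + 1
        \<and> card {i. m \<le> i \<and> i + m + 2 \<le> 4 * n \<and> ch i} \<le> 4 * w * real (K + 1)"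
      by (rule card_le_dyadic_windows[OF n]) (use window real in simp)
    then obtain m where m: "1 \<le> m" "m \<le> n" "real m \<le> real n / 2 ^ K + 1"
      "card {i. m \<le> i \<and> i + m + 2 \<le> 4 * n \<and> ch i} \<le> 4 * w * real (K + 1)" by blast
    let ?M = "{i. m \<le> i \<and> i + m + 2 \<le> 4 * n \<and> ch i}"
    have "finite ?M" by (rule finite_subset[of _ "{..4 * n}"]) auto
    then have "r \<le> card (?M \<union> {..<m} \<union> {4 * n - 1 - m..4 * n - 2})"
      unfolding r_eq by (intro card_mono) auto
    also have "\<dots> \<le> card ?M + card {..<m} + card {4 * n - 1 - m..4 * n - 2}"
      by (intro order_trans[OF card_Un_le] add_right_mono card_Un_le)
    also have "\<dots> \<le> card ?M + m + m"
    proof -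
      have "card {4 * n - 1 - m..4 * n - 2} \<le> m" using n m(2) by simp
      then show ?thesis by simp
    qed
    finally have r_le: "real r \<le> real (card ?M) + real m + real m" by linarith
    have "8 * real n / real r = 2 powr log 2 (8 * real n / real r)"
      using n r4 by simp
    also have "\<dots> \<le> 2 powr real K"
      unfolding K_def by (intro powr_mono) linarith+
    finally have "8 * real n / real r \<le> 2 ^ K" by (simp add: powr_realpow)
    then have "real n / 2 ^ K \<le> r / 8" using r4 by (simp add: field_simps)
    then have "real m \<le> r / 8 + 1"
      by (rule order_trans[OF m(3) add_right_mono])
    then have "real r \<le> 4 * real (card ?M)" using r_le r4 by linarith
    also have "\<dots> \<le> 16 * (w * real (K + 1))" using m(4) by simp
    also have "w * real (K + 1) \<le> w * (6 * L)"
    proof (rule mult_left_mono)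
      have "log 2 (8 * real n / real r) = 3 + log 2 (real n / real r)"
      proof -
        have "log 2 (8 :: real) = log 2 (2 ^ 3)" by simp
        also have "\<dots> = 3" by (subst log_nat_power) auto
        finally have "log 2 (8 :: real) = 3" .
        then show ?thesis using n r4 by (simp add: log_mult log_divide)
      qed
      \<comment> \<open>Rounding up adds at most 1 to \<open>3 + log 2 (n / r)\<close>, and
        \<open>nat\<close> replaces a negative value by 0; since \<open>L \<ge> 1\<close>, the
        constants are absorbed into \<open>6 * L\<close>.\<close>
      then have "real K \<le> max 0 (4 + log 2 (real n / real r))"
        unfolding K_def by linarith
      then show "real (K + 1) \<le> 6 * L" unfolding L_def by linarith
      show "0 \<le> w" using window[of 0 0] real by simp
    qed
    finally have "1 / 96 * real r \<le> w * L" by simp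
    moreover have "L > 0" by (simp add: L_def)
    ultimately show ?thesis using real by (simp add: field_simps)
  qed
  then show "ereal (1 / 96 * real r / max 1 (log 2 (real n / real r)))
      \<le> PP_cc (cube (4 * n)) (cube (4 * n)) (compose_XOR F)"
    by (simp add: PP_def L_def)
qed simp

end
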